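(* Let $\Sigma$ be an alphabet (not necessarily finite) with $|\Sigma|\ge 3$, and let the set $\Sigma^{\mathbb{N}_0}$ of infinite words over $\Sigma$ be equipped with the Cantor topology. Then for every $c\in[1,\infty]$, the set $\{\mathbf{a}\in\Sigma^{\mathbb{N}_0}:\mathbf{Rdio}(\mathbf{a})=c\}$ is dense in $\Sigma^{\mathbb{N}_0}$.
   Context: An infinite word over $\Sigma$ is a sequence $\mathbf{a}=a_0a_1a_2\cdots$ with $a_i\in\Sigma$. The Cantor topology is the topology whose basic open sets are the cylinder sets $[w]$, where for a finite word $w$ over $\Sigma$, $[w]$ is the set of all infinite words over $\Sigma$ having $w$ as a prefix. For integers $0\le r\le s$, $\mathbf{a}[r,s]$ denotes the finite word $a_ra_{r+1}\cdots a_s$. $(\epsilon,\delta)$-closeness: for two finite words $U=u_1\cdots u_L$ and $V=v_1\cdots v_L$ of the same length $L>0$, a real $\epsilon>0$ and an integer $\delta\ge 0$, $U$ and $V$ are $(\epsilon,\delta)$-close if there exist $\delta$ (possibly empty) subintervals $I_1,\dots,I_\delta$ of $\{1,\dots,L\}$ such that $\{1\le i\le L: u_i\ne v_i\}\subseteq \bigcup_{j=1}^{\delta} I_j$ and $\left|\bigcup_{j=1}^{\delta} I_j\right|\le \epsilon L$. Refined Diophantine exponent: for a real $\rho\ge 1$, $\mathbf{a}$ satisfies Condition $( * )_\rho$ if for every $\epsilon>0$ there exist three sequences of integers $(r_n)_{n\ge0}$, $(s_n)_{n\ge0}$, $(t_n)_{n\ge0}$ and an integer $\delta\ge0$ such that: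 $-1\le r_n<s_n<t_n$ for all $n$; $t_n\ge\rho s_n$ for all $n$; $s_n-r_n\to\infty$ as $n\to\infty$; and for all $n$ large enough, $\mathbf{a}[r_n+1,r_n+t_n-s_n]$ and $\mathbf{a}[s_n+1,t_n]$ are $(\epsilon,\delta)$-close. The refined Diophantine exponent $\mathbf{Rdio}(\mathbf{a})\in[1,\infty]$ is the supremum of the $\rho\ge1$ for which $\mathbf{a}$ satisfies $( * )_\rho$ (equal to $1$ by convention if there is no such $\rho$, which can only happen over an infinite alphabet). *)

theory Defs
  imports "HOL-Analysis.Analysis"
begin

definition infinite_words :: "'a set \<Rightarrow> (nat \<Rightarrow> 'a) set" where
  "infinite_words \<Sigma> = {a. range a \<subseteq> \<Sigma>}"

definition cylinder :: "'a set \<Rightarrow> 'a list \<Rightarrow> (nat \<Rightarrow> 'a) set" where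
  "cylinder \<Sigma> w = {a \<in> infinite_words \<Sigma>. \<forall>i < length w. a i = w ! i}"

definition cantor_topology :: "'a set \<Rightarrow> (nat \<Rightarrow> 'a) topology" where
  "cantor_topology \<Sigma> = topology_generated_by (cylinder \<Sigma> ` lists \<Sigma>)"

lemma topspace_cantor_topology [simp]: "topspace (cantor_topology \<Sigma>) = infinite_words \<Sigma>"
proof -
  have "cylinder \<Sigma> [] = infinite_words \<Sigma>"
    by (simp add: cylinder_def)
  then show ?thesis
    unfolding cantor_topology_def topology_generated_by_topspace
    by (auto simp: cylinder_def intro!: bexI[of _ "[]"])
qed

text \<open>The cylinders are a base, not merely a subbase.\<close>

lemma openin_cantor_topology_iff:
  "openin (cantor_topology \<Sigma>) S \<longleftrightarrow>
    S \<subseteq> infinite_words \<Sigma> \<and>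
    (\<forall>a\<in>S. \<exists>w\<in>lists \<Sigma>. a \<in> cylinder \<Sigma> w \<and> cylinder \<Sigma> w \<subseteq> S)"
proof
  assume op: "openin (cantor_topology \<Sigma>) S"
  then have "generate_topology_on (cylinder \<Sigma> ` lists \<Sigma>) S"
    by (simp add: cantor_topology_def openin_topology_generated_by_iff)
  then have "\<forall>a\<in>S. \<exists>w\<in>lists \<Sigma>. a \<in> cylinder \<Sigma> w \<and> cylinder \<Sigma> w \<subseteq> S"
  proof induction
    case (Int A B)
    show ?case
    proof
      fix a assume a: "a \<in> A \<inter> B"
      then obtain v w where v: "v \<in> lists \<Sigma>" "a \<in> cylinder \<Sigma> v" "cylinder \<Sigma> v \<subseteq> A"
        and w: "w \<in> lists \<Sigma>" "a \<in> cylinder \<Sigma> w" "cylinder \<Sigma> w \<subseteq> B"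
        using Int.IH by (meson IntE)
      define u where "u = (if length v \<le> length w then w else v)"
      have "cylinder \<Sigma> u \<subseteq> cylinder \<Sigma> v \<inter> cylinder \<Sigma> w"
        using v(2) w(2) by (auto simp: u_def cylinder_def)
      moreover have "u \<in> lists \<Sigma>" "a \<in> cylinder \<Sigma> u"
        using v w by (auto simp: u_def)
      ultimately show "\<exists>w\<in>lists \<Sigma>. a \<in> cylinder \<Sigma> w \<and> cylinder \<Sigma> w \<subseteq> A \<inter> B"
        using v(3) w(3) by blast
    qed
  next
    case (UN K)
    then show ?case
      by (meson Union_iff Union_upper order_trans)
  qed auto
  then show "S \<subseteq> infinite_words \<Sigma> \<and>
      (\<forall>a\<in>S. \<exists>w\<in>lists \<Sigma>. a \<in> cylinder \<Sigma> w \<and> cylinder \<Sigma> w \<subseteq> S)"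
    using openin_subset[OF op] by simp
next
  assume S: "S \<subseteq> infinite_words \<Sigma> \<and>
      (\<forall>a\<in>S. \<exists>w\<in>lists \<Sigma>. a \<in> cylinder \<Sigma> w \<and> cylinder \<Sigma> w \<subseteq> S)"
  have "openin (cantor_topology \<Sigma>) (cylinder \<Sigma> w)" if "w \<in> lists \<Sigma>" for w
    using that by (auto simp: cantor_topology_def intro: topology_generated_by_Basis)
  with S show "openin (cantor_topology \<Sigma>) S"
    by (metis (no_types, lifting) openin_subopen)
qed

text \<open>The finite word with letters of index \<open>r, \<dots>, s\<close>; only used for \<open>0 \<le> r\<close>, where the
  truncation by \<^const>\<open>nat\<close> is harmless.\<close>

definition factor :: "(nat \<Rightarrow> 'a) \<Rightarrow> int \<Rightarrow> int \<Rightarrow> 'a list" where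
  "factor a r s = map (\<lambda>i. a (nat i)) [r..s]"

text \<open>Positions in a finite word are counted from 1, so that \<open>U ! (i - 1)\<close> is the \<open>i\<close>-th letter.\<close>

definition eps_delta_close :: "real \<Rightarrow> nat \<Rightarrow> 'a list \<Rightarrow> 'a list \<Rightarrow> bool" where
  "eps_delta_close \<epsilon> \<delta> U V \<longleftrightarrow>
    length U = length V \<and> length U > 0 \<and>
    (\<exists>I :: nat \<Rightarrow> nat set.
      (\<forall>j\<in>{1..\<delta>}. I j \<subseteq> {1..length U} \<and> (\<exists>l u. I j = {l..u})) \<and>
      {i \<in> {1..length U}. U ! (i - 1) \<noteq> V ! (i - 1)} \<subseteq> (\<Union>j\<in>{1..\<delta>}. I j) \<and>
      real (card (\<Union>j\<in>{1..\<delta>}. I j)) \<le> \<epsilon> * real (length U))"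

definition rdio_condition :: "(nat \<Rightarrow> 'a) \<Rightarrow> real \<Rightarrow> bool" where
  "rdio_condition a \<rho> \<longleftrightarrow>
    (\<forall>\<epsilon>>0. \<exists>(r :: nat \<Rightarrow> int) (s :: nat \<Rightarrow> int) (t :: nat \<Rightarrow> int) (\<delta> :: nat).
      (\<forall>n. -1 \<le> r n \<and> r n < s n \<and> s n < t n) \<and>
      (\<forall>n. real_of_int (t n) \<ge> \<rho> * real_of_int (s n)) \<and>
      filterlim (\<lambda>n. s n - r n) at_top sequentially \<and>
      (\<forall>\<^sub>F n in sequentially.
        eps_delta_close \<epsilon> \<delta>
          (factor a (r n + 1) (r n + t n - s n)) (factor a (s n + 1) (t n))))"

text \<open>The refined Diophantine exponent, with the convention that it is 1 if no \<open>\<rho>\<close> qualifies.\<close>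

definition Rdio :: "(nat \<Rightarrow> 'a) \<Rightarrow> ereal" where
  "Rdio a =
    (if \<exists>\<rho>\<ge>1. rdio_condition a \<rho>
     then (SUP \<rho>\<in>{\<rho>. 1 \<le> \<rho> \<and> rdio_condition a \<rho>}. ereal \<rho>)
     else 1)"

end

theory Submission imports Defs begin

text \<open>Given a finite word \<open>w\<close>, continue it by the letter \<open>z\<close> on the zones \<open>(k!, c k!]\<close>, and elsewhere by
  \<open>x\<close> at the squares and \<open>y\<close> at the non-squares. Comparing the zone after \<open>k!\<close> with a small shift of
  itself shows that the exponent is at least \<open>c\<close>. Conversely, if \<open>t \<ge> \<rho> s\<close> with \<open>\<rho> > c\<close>, then, the
  ratios of consecutive factorials being unbounded, a fixed proportion of \<open>(s, t]\<close> is an interval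
  avoiding all zones. If \<open>\<epsilon>\<close> is small compared with that proportion, closeness forces an exact match
  of length linear in \<open>t\<close> inside this interval, which therefore contains two consecutive squares.
  But the gaps between consecutive squares are distinct, so no such factor occurs twice.\<close>

section \<open>The witness words\<close>

text \<open>Stating the bound in \<open>ereal\<close> treats all exponents alike: for
  \<open>c = \<infinity>\<close> every \<open>m > 1\<close> belongs to a zone and the word is
  eventually constant, while for \<open>c = 1\<close> all zones are empty.\<close>

definition zones :: "ereal \<Rightarrow> nat set" where
  "zones c = {m. \<exists>k. fact k < m \<and> ereal (real m) \<le> c * ereal (fact k)}"

definition zone_word :: "'a list \<Rightarrow> ereal \<Rightarrow> 'a \<Rightarrow> 'a \<Rightarrow> 'a \<Rightarrow> nat \<Rightarrow> 'a" where
  "zone_word w c x y z i =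
    (if i < length w then w ! i
     else if i \<in> zones c then z
     else if \<exists>k. i = k\<^sup>2 then x else y)"

section \<open>Order bounds for the exponent\<close>

lemma Rdio_ge:
  assumes "1 \<le> \<rho>" "rdio_condition a \<rho>"
  shows "ereal \<rho> \<le> Rdio a"
  using assms unfolding Rdio_def by (auto intro: SUP_upper)

lemma Rdio_ge_1: "1 \<le> Rdio a"
proof (cases "\<exists>\<rho>\<ge>1. rdio_condition a \<rho>")
  case True
  then obtain \<rho> where \<rho>: "1 \<le> \<rho>" "rdio_condition a \<rho>"
    by blast
  have "1 \<le> ereal \<rho>"
    using \<rho>(1) by simp
  also have "\<dots> \<le> Rdio a"
    using \<rho> by (rule Rdio_ge)
  finally show ?thesis .
next
  case False
  then have "Rdio a = 1"
    unfolding Rdio_def by (rule if_not_P)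
  then show ?thesis
    by simp
qed

lemma Rdio_le:
  assumes "1 \<le> c" "\<And>\<rho>. 1 \<le> \<rho> \<Longrightarrow> c < ereal \<rho> \<Longrightarrow> \<not> rdio_condition a \<rho>"
  shows "Rdio a \<le> c"
proof -
  have "ereal \<rho> \<le> c" if "1 \<le> \<rho>" "rdio_condition a \<rho>" for \<rho>
    using assms(2) that by (meson not_le)
  then show ?thesis
    using assms(1) unfolding Rdio_def by (auto intro!: SUP_least)
qed

section \<open>Lower bound from long constant stretches\<close>

text \<open>Two windows inside one constant stretch agree exactly whatever the shift, so
  \<open>\<delta> = 0\<close> serves every \<open>\<epsilon>\<close>. The gap between
  \<open>\<rho>\<close> and \<open>\<rho>'\<close> pays for a shift that tends to infinity.\<close>

lemma rdio_condition_if_constant_intervals: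
  fixes a :: "nat \<Rightarrow> 'a"
  assumes "1 \<le> \<rho>" "\<rho> < \<rho>'"
    and const: "\<And>N. \<exists>S\<ge>N. \<forall>i. S < i \<and> real i \<le> \<rho>' * real S \<longrightarrow> a i = z"
  shows "rdio_condition a \<rho>"
proof -
  \<comment> \<open>The term \<open>real n + 1\<close> is the shift to be used; the final
    \<open>1\<close> absorbs the rounding of \<open>\<rho>' * real S\<close> to an integer. A large
    \<open>S\<close> suffices because \<open>\<rho> < \<rho>'\<close>.\<close>
  have "\<exists>S. \<rho> * (real S + real n + 1) + 1 \<le> \<rho>' * real S \<and>
      (\<forall>i. S < i \<and> real i \<le> \<rho>' * real S \<longrightarrow> a i = z)" for n
  proof -
    obtain N :: nat where N: "(\<rho> * (real n + 1) + 1) / (\<rho>' - \<rho>) \<le> real N"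
      using real_arch_simple by blast
    obtain S where S: "S \<ge> N" "\<forall>i. S < i \<and> real i \<le> \<rho>' * real S \<longrightarrow> a i = z"
      using const by blast
    have "(\<rho> * (real n + 1) + 1) / (\<rho>' - \<rho>) \<le> real S"
      using N S(1) by linarith
    then have "\<rho> * (real n + 1) + 1 \<le> real S * (\<rho>' - \<rho>)"
      using assms(2) by (simp add: pos_divide_le_eq)
    then show ?thesis
      using S(2) by (intro exI[of _ S]) (auto simp: algebra_simps)
  qed
  then obtain S where S: "\<And>n. \<rho> * (real (S n) + real n + 1) + 1 \<le> \<rho>' * real (S n)"
    and Sz: "\<And>n i. S n < i \<Longrightarrow> real i \<le> \<rho>' * real (S n) \<Longrightarrow> a i = z"
    by metis
  \<comment> \<open>Both windows lie in the constant stretch that starts right after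
    \<open>S n\<close>; their shift is \<open>n + 1\<close>.\<close>
  define r s t where "r n = int (S n)" and "s n = int (S n + n + 1)" and "t n = \<lfloor>\<rho>' * real (S n)\<rfloor>"
    for n
  have rs: "-1 \<le> r n \<and> r n < s n" for n
    by (simp add: r_def s_def)
  have ts: "\<rho> * real_of_int (s n) < real_of_int (t n)" for n
  proof -
    have "real_of_int (s n) = real (S n) + real n + 1"
      by (simp add: s_def)
    moreover have "\<rho>' * real (S n) < real_of_int (t n) + 1"
      unfolding t_def by linarith
    ultimately show ?thesis
      using S[of n] by (simp only:)
  qed
  have st: "s n < t n" for n
  proof -
    have "1 * real_of_int (s n) \<le> \<rho> * real_of_int (s n)"
      using assms(1) by (intro mult_right_mono) (auto simp: s_def)
    with ts[of n] show ?thesis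
      by linarith
  qed
  have az: "a (nat i) = z" if "r n < i" "i \<le> t n" for n i
  proof (rule Sz)
    show "S n < nat i"
      using that(1) by (simp add: r_def zless_nat_eq_int_zless)
    have "real_of_int i \<le> \<rho>' * real (S n)"
      using that(2) unfolding t_def by (simp add: le_floor_iff)
    then show "real (nat i) \<le> \<rho>' * real (S n)"
      using that(1) by (simp add: r_def)
  qed
  have "eps_delta_close \<epsilon> 0 (factor a (r n + 1) (r n + t n - s n)) (factor a (s n + 1) (t n))"
    if "0 < \<epsilon>" for \<epsilon> n
  proof -
    have "factor a (r n + 1) (r n + t n - s n) = replicate (nat (t n - s n)) z"
      unfolding factor_def using rs[of n] st[of n]
      by (intro replicate_eqI) (auto intro!: az[of n])
    moreover have "factor a (s n + 1) (t n) = replicate (nat (t n - s n)) z"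
      unfolding factor_def using rs[of n] st[of n]
      by (intro replicate_eqI) (auto intro!: az[of n])
    ultimately show ?thesis
      using st[of n] that by (auto simp: eps_delta_close_def)
  qed
  moreover have "filterlim (\<lambda>n. s n - r n) at_top sequentially"
    unfolding r_def s_def filterlim_at_top
  proof
    fix Z :: int
    show "\<forall>\<^sub>F n in sequentially. Z \<le> int (S n + n + 1) - int (S n)"
      using eventually_ge_at_top[of "nat Z"] by eventually_elim auto
  qed
  ultimately show ?thesis
    unfolding rdio_condition_def using rs st ts
    by (intro allI impI exI[of _ r] exI[of _ s] exI[of _ t] exI[of _ 0])
      (auto intro: less_imp_le)
qed

lemma rdio_condition_zone_word:
  assumes "1 \<le> \<rho>" "ereal \<rho> < c"
  shows "rdio_condition (zone_word w c x y z) \<rho>"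
proof -
  \<comment> \<open>The intermediate real supplies the required slack, and it is finite even if
    \<open>c\<close> is not.\<close>
  obtain \<rho>' where \<rho>': "\<rho> < \<rho>'" "ereal \<rho>' \<le> c"
    using ereal_dense2[OF assms(2)] by (auto intro: less_imp_le)
  show ?thesis
  proof (rule rdio_condition_if_constant_intervals[OF assms(1) \<rho>'(1)])
    fix N
    \<comment> \<open>As \<open>k \<le> fact k\<close>, the zone after \<open>fact k\<close> starts
      beyond both \<open>N\<close> and the prefix \<open>w\<close>.\<close>
    define k where "k = max N (length w)"
    have k: "k \<le> fact k"
      by (rule fact_ge_self)
    have "zone_word w c x y z i = z" if "fact k < i" "real i \<le> \<rho>' * real (fact k)" for i
    proof -
      have "ereal (real i) \<le> ereal \<rho>' * ereal (fact k)"
        using that(2) by simp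
      also have "\<dots> \<le> c * ereal (fact k)"
        using \<rho>'(2) by (intro ereal_mult_right_mono) auto
      finally have "i \<in> zones c"
        using that(1) unfolding zones_def by auto
      moreover have "\<not> i < length w"
        using that(1) k unfolding k_def by linarith
      ultimately show ?thesis
        by (simp add: zone_word_def)
    qed
    moreover have "N \<le> fact k"
      using k unfolding k_def by linarith
    ultimately show "\<exists>S\<ge>N. \<forall>i. S < i \<and> real i \<le> \<rho>' * real S \<longrightarrow> zone_word w c x y z i = z"
      by blast
  qed
qed

section \<open>Closeness as shift invariance outside few intervals\<close>

text \<open>Closeness speaks of positions inside the two factors, counted from 1. Position
  \<open>i\<close> there is position \<open>s + i\<close> of \<open>a\<close> in the second factor
  and \<open>r + i\<close> in the first, so translating the intervals by \<open>s\<close> turns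
  closeness into invariance of \<open>a\<close> under a shift by \<open>s - r\<close>. Even for
  \<open>r = -1\<close> no index is truncated, because \<open>i \<ge> 1\<close>.\<close>

lemma eps_delta_close_factorD:
  assumes "-1 \<le> r" "r < s" "s < t"
    and close: "eps_delta_close \<epsilon> \<delta> (factor a (r + 1) (r + t - s)) (factor a (s + 1) t)"
  obtains l u :: "nat \<Rightarrow> nat" where
    "real (card (\<Union>j\<in>{1..\<delta>}. {l j..u j})) \<le> \<epsilon> * real (nat (t - s))"
    "\<And>i. i \<in> {nat s<..nat t} - (\<Union>j\<in>{1..\<delta>}. {l j..u j}) \<Longrightarrow> a i = a (i - nat (s - r))"
proof -
  have len: "length (factor a (r + 1) (r + t - s)) = nat (t - s)"
    by (simp add: factor_def)
  obtain I where I: "\<forall>j\<in>{1..\<delta>}. \<exists>l u. I j = {l..u::nat}"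
    and mis: "{i \<in> {1..nat (t - s)}. factor a (r + 1) (r + t - s) ! (i - 1) \<noteq> factor a (s + 1) t ! (i - 1)}
       \<subseteq> (\<Union>j\<in>{1..\<delta>}. I j)"
    and card: "real (card (\<Union>j\<in>{1..\<delta>}. I j)) \<le> \<epsilon> * real (nat (t - s))"
    using close unfolding eps_delta_close_def len by (elim conjE exE) blast
  obtain l u where lu: "\<And>j. j \<in> {1..\<delta>} \<Longrightarrow> I j = {l j..u j}"
    using I by metis
  define S where "S = nat s"
  have eq: "(\<Union>j\<in>{1..\<delta>}. {l j + S..u j + S}) = (\<lambda>i. i + S) ` (\<Union>j\<in>{1..\<delta>}. I j)"
    using lu by (simp add: image_UN)
  show ?thesis
  proof (rule that)
    have "card (\<Union>j\<in>{1..\<delta>}. {l j + S..u j + S}) = card (\<Union>j\<in>{1..\<delta>}. I j)"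
      unfolding eq by (rule card_image) (simp add: inj_on_def)
    then show "real (card (\<Union>j\<in>{1..\<delta>}. {l j + S..u j + S})) \<le> \<epsilon> * real (nat (t - s))"
      using card by simp
    fix i assume i: "i \<in> {nat s<..nat t} - (\<Union>j\<in>{1..\<delta>}. {l j + S..u j + S})"
    define i' where "i' = i - S"
    have i': "i = i' + S" "i' \<in> {1..nat (t - s)}"
      using i assms unfolding i'_def S_def by auto
    have "i \<notin> (\<lambda>i. i + S) ` (\<Union>j\<in>{1..\<delta>}. I j)"
      using i[unfolded eq] by (simp only: Diff_iff not_False_eq_True)
    then have "i' \<notin> (\<Union>j\<in>{1..\<delta>}. I j)"
      unfolding i'(1) by (rule contrapos_nn) (rule imageI)
    then have "factor a (r + 1) (r + t - s) ! (i' - 1) = factor a (s + 1) t ! (i' - 1)"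
      using subsetD[OF mis, of i'] i'(2) by fast
    moreover have "factor a (r + 1) (r + t - s) ! (i' - 1) = a (nat (r + int i'))"
      "factor a (s + 1) t ! (i' - 1) = a (nat (s + int i'))"
    proof -
      have "int (i' - 1) = int i' - 1" "i' - 1 < nat (t - s)" "int i' \<le> t - s"
        using i'(2) by auto
      then show "factor a (r + 1) (r + t - s) ! (i' - 1) = a (nat (r + int i'))"
        "factor a (s + 1) t ! (i' - 1) = a (nat (s + int i'))"
        unfolding factor_def by (simp_all add: nth_upto)
    qed
    moreover have "nat (s + int i') = i" "nat (r + int i') = i - nat (s - r)"
      using i' assms unfolding S_def by auto
    ultimately show "a i = a (i - nat (s - r))"
      by simp
  qed
qed

text \<open>A point of the complement lies at most \<open>m\<close> before the next point of the union, which is the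
  left end of one of the intervals, or before the right end \<open>q\<close>.\<close>

lemma card_diff_UN_intervals_le:
  fixes l u :: "nat \<Rightarrow> nat" and \<delta> :: nat
  defines "U \<equiv> (\<Union>j\<in>{1..\<delta>}. {l j..u j})"
  assumes meets: "\<And>v. p \<le> v \<Longrightarrow> v + m \<le> q \<Longrightarrow> {v<..v + m} \<inter> U \<noteq> {}"
  shows "card ({p<..q} - U) \<le> (\<delta> + 1) * m"
proof -
  \<comment> \<open>Index \<open>0\<close> encodes the right end as \<open>Suc q\<close>, so that
    all \<open>\<delta> + 1\<close> covering blocks have the same half-open form with at most
    \<open>m\<close> points.\<close>
  define e where "e j = (if j = 0 then Suc q else l j)" for j
  have "{p<..q} - U \<subseteq> (\<Union>j\<in>{0..\<delta>}. {e j - m..<e j})"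
  proof
    fix i assume i: "i \<in> {p<..q} - U"
    show "i \<in> (\<Union>j\<in>{0..\<delta>}. {e j - m..<e j})"
    proof (cases "i - 1 + m \<le> q")
      case False
      then have "i \<in> {e 0 - m..<e 0}"
        using i by (auto simp: e_def)
      then show ?thesis
        by fastforce
    next
      case True
      have "{i - 1<..i - 1 + m} \<inter> U \<noteq> {}"
        using i True by (intro meets) auto
      then obtain f where "f \<in> {i - 1<..i - 1 + m}" and f: "f \<in> U"
        by blast
      then have if': "i \<le> f" "f \<le> i - 1 + m"
        by auto
      \<comment> \<open>The first point of \<open>U\<close> from \<open>i\<close> on. As
        \<open>g - 1\<close> is outside \<open>U\<close>, \<open>g\<close> must be the left end of
        any interval containing it.\<close>
      define g where "g = (LEAST g. g \<in> U \<and> i \<le> g)"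
      have g: "g \<in> U" "i \<le> g"
        using f if' LeastI[of "\<lambda>g. g \<in> U \<and> i \<le> g" f] unfolding g_def by auto
      have gf: "g \<le> f"
        using f if' unfolding g_def by (intro Least_le) auto
      have "i < g"
        using g i by (metis DiffD2 le_neq_implies_less)
      then have g1: "g - 1 \<notin> U"
        using not_less_Least[of "g - 1" "\<lambda>g. g \<in> U \<and> i \<le> g"] unfolding g_def[symmetric] by auto
      obtain j where j: "j \<in> {1..\<delta>}" "g \<in> {l j..u j}"
        using g(1) unfolding U_def by blast
      moreover have "g - 1 \<notin> {l j..u j}"
        using g1 j(1) unfolding U_def by blast
      ultimately have "g = l j"
        using \<open>i < g\<close> by auto
      then have "i \<in> {e j - m..<e j}"
        using \<open>i < g\<close> gf if'(2) i j(1) by (auto simp: e_def)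
      then show ?thesis
        using j(1) by fastforce
    qed
  qed
  then have "card ({p<..q} - U) \<le> card (\<Union>j\<in>{0..\<delta>}. {e j - m..<e j})"
    by (intro card_mono) auto
  also have "\<dots> \<le> (\<Sum>j\<in>{0..\<delta>}. card {e j - m..<e j})"
    by (intro card_UN_le) auto
  also have "\<dots> \<le> (\<Sum>j\<in>{0..\<delta>}. m)"
    by (intro sum_mono) auto
  finally show ?thesis
    by simp
qed

section \<open>Gaps between consecutive squares\<close>

text \<open>Let \<open>k\<close> be least with \<open>v < k\<^sup>2\<close>. Then the square of
  \<open>k - 1\<close> is at most \<open>v\<close>, and going from it to the square of
  \<open>k + 1\<close> adds \<open>4 * k\<close>, which is at most \<open>4 * q + 4\<close>.\<close>

lemma consecutive_squares_in_interval:
  fixes v q :: nat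
  assumes "v < (q + 1)\<^sup>2"
  obtains k where "v < k\<^sup>2" "(k + 1)\<^sup>2 \<le> v + (4 * q + 4)"
proof -
  define k where "k = (LEAST k. v < k\<^sup>2)"
  have vk: "v < k\<^sup>2" and kq: "k \<le> q + 1"
    using assms LeastI[of "\<lambda>k. v < k\<^sup>2" "q + 1"] unfolding k_def by (auto intro: Least_le)
  then obtain k' where k': "k = Suc k'"
    by (cases k) auto
  have "k'\<^sup>2 \<le> v"
    using not_less_Least[of k' "\<lambda>k. v < k\<^sup>2"] k' unfolding k_def[symmetric] by auto
  then have "(k + 1)\<^sup>2 \<le> v + (4 * q + 4)"
    using k' kq by (simp add: power2_eq_square)
  with vk show ?thesis
    using that by blast
qed

text \<open>The letters from \<open>k\<^sup>2\<close> to \<open>(k + 1)\<^sup>2\<close> are an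
  \<open>x\<close>, then \<open>2 * k\<close> letters \<open>y\<close>, then an \<open>x\<close>. An
  earlier copy beyond the prefix would start at a smaller square \<open>f\<^sup>2\<close>, and the
  next square, being closer, would fall among its letters \<open>y\<close>.\<close>

lemma zone_word_no_shifted_gap:
  fixes w :: "'a list"
  defines "n \<equiv> length w"
  assumes dist: "x \<noteq> y" "x \<noteq> z" "y \<noteq> z"
    and large: "n\<^sup>2 < k" and p: "0 < p" "p \<le> k\<^sup>2"
    and nz: "{k\<^sup>2..(k + 1)\<^sup>2} \<inter> zones c = {}"
    and shift: "\<And>i. i \<in> {k\<^sup>2..(k + 1)\<^sup>2} \<Longrightarrow>
      zone_word w c x y z i = zone_word w c x y z (i - p)"
  shows False
proof -
  let ?a = "zone_word w c x y z"
  have nn: "n \<le> n\<^sup>2"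
    by (simp add: power2_nat_le_imp_le self_le_power)
  have kk: "k \<le> k\<^sup>2"
    by (simp add: power2_eq_square)
  have sq: "(k + 1)\<^sup>2 = k\<^sup>2 + 2 * k + 1"
    by (simp add: power2_eq_square)
  then have "k\<^sup>2 \<le> (k + 1)\<^sup>2"
    by linarith
  have ge: "n \<le> i" if "k\<^sup>2 \<le> i" for i
    using that nn kk large by linarith
  have square: "?a (j\<^sup>2) = x" if "n \<le> j\<^sup>2" "j\<^sup>2 \<notin> zones c" for j
    using that by (auto simp: zone_word_def n_def)
  have "k\<^sup>2 \<notin> zones c" "(k + 1)\<^sup>2 \<notin> zones c"
    using nz unfolding disjoint_iff by (simp_all add: sq)
  then have ax: "?a (k\<^sup>2) = x" "?a ((k + 1)\<^sup>2) = x"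
    using square[of k] square[of "k + 1"] ge[of "k\<^sup>2"] ge[of "(k + 1)\<^sup>2"] \<open>k\<^sup>2 \<le> (k + 1)\<^sup>2\<close>
    by blast+
  have ay: "?a i = y" if "k\<^sup>2 < i" "i < (k + 1)\<^sup>2" for i
  proof -
    have "\<nexists>j. i = j\<^sup>2"
    proof
      assume "\<exists>j. i = j\<^sup>2"
      then obtain j where "i = j\<^sup>2" ..
      with that have "k < j" "j < k + 1"
        using power_less_imp_less_base[of k 2 j] power_less_imp_less_base[of j 2 "k + 1"] by auto
      then show False
        by simp
    qed
    moreover have "i \<notin> zones c"
      using that nz by (auto simp: disjoint_iff)
    ultimately show ?thesis
      using that(1) ge[of i] by (simp add: zone_word_def n_def)
  qed
  define b where "b = k\<^sup>2 - p"
  have "(k + 1)\<^sup>2 - p = b + 2 * k + 1"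
    using p(2) unfolding b_def sq by simp
  then have bx: "?a b = x" "?a (b + 2 * k + 1) = x"
    using shift[of "k\<^sup>2"] shift[of "(k + 1)\<^sup>2"] ax unfolding b_def sq by simp_all
  have byy: "?a i = y" if "b < i" "i < b + 2 * k + 1" for i
  proof -
    have "k\<^sup>2 < i + p" "i + p < (k + 1)\<^sup>2"
      using that p(2) unfolding b_def sq by linarith+
    then show ?thesis
      using shift[of "i + p"] ay[of "i + p"] by simp
  qed
  \<comment> \<open>Beyond the prefix a square carries \<open>z\<close> inside a zone and
    \<open>x\<close> outside. Any such square strictly inside the copied gap is therefore a
    contradiction.\<close>
  have square_not_y: "?a (j\<^sup>2) \<noteq> y" if "n \<le> j\<^sup>2" for j
    using that dist by (auto simp: zone_word_def n_def)
  show False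
  proof (cases "b < n")
    case True
    \<comment> \<open>The shifted gap starts inside the prefix \<open>w\<close> and is long enough to cover the square \<open>n\<^sup>2\<close>.\<close>
    then show False
      using byy[of "n\<^sup>2"] square_not_y[of n] nn large by linarith
  next
    case False
    then obtain f g where fg: "b = f\<^sup>2" "b + 2 * k + 1 = g\<^sup>2"
      using bx dist by (auto simp: zone_word_def n_def split: if_splits)
    have "f\<^sup>2 < k\<^sup>2"
      using fg(1) p by (auto simp: b_def)
    then have "f < k"
      by (simp add: power_less_imp_less_base)
    then have "f\<^sup>2 < (f + 1)\<^sup>2 \<and> (f + 1)\<^sup>2 < f\<^sup>2 + 2 * k + 1"
      by (simp add: power2_eq_square)
    then show False
      using byy[of "(f + 1)\<^sup>2"] square_not_y[of "f + 1"] False fg(1) by linarith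
  qed
qed

section \<open>Long intervals avoiding the zones\<close>

text \<open>Let \<open>fact k\<close> be the last factorial up to \<open>t\<close>. If its zone ends
  well before \<open>t\<close>, the stretch between that end and \<open>t\<close> is free. Otherwise
  \<open>fact k\<close> is comparable to \<open>t\<close>, and the stretch just before
  \<open>fact k\<close> is free and long, since the preceding zone ends far below it. In both cases
  the interval also has to start at or after \<open>s\<close>.\<close>

lemma zone_free_interval:
  assumes c: "1 \<le> c" "c < \<rho>"
  obtains \<eta> :: real and T :: nat where "0 < \<eta>"
    "\<And>s t :: nat. T \<le> t \<Longrightarrow> \<rho> * real s \<le> real t \<Longrightarrow>
      \<exists>p q. s \<le> p \<and> q \<le> t \<and> {p<..q} \<inter> zones (ereal c) = {} \<and> \<eta> * real t \<le> real q - real p"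
proof -
  \<comment> \<open>The square root splits the ratio \<open>c / \<rho>\<close> evenly between the
    two cases: \<open>s\<close> is at most \<open>\<theta> * t\<close> in general, and at most
    \<open>\<theta> * fact k\<close> once \<open>\<theta> * t < c * fact k\<close>.\<close>
  define \<theta> where "\<theta> = sqrt (c / \<rho>)"
  have \<theta>: "0 < \<theta>" "\<theta> < 1" "\<theta> * \<theta> * \<rho> = c"
    using c by (auto simp: \<theta>_def)
  have \<theta>\<rho>: "1 \<le> \<theta> * \<rho>"
  proof -
    have "\<theta> * (\<theta> * \<rho>) \<le> 1 * (\<theta> * \<rho>)"
      using \<theta> c by (intro mult_right_mono) auto
    with \<theta>(3) c(1) show ?thesis
      by (simp add: mult.assoc)
  qed
  \<comment> \<open>The proportion from the second case, where the length is at least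
    \<open>(1 - \<theta>) * fact k\<close> and \<open>fact k\<close> exceeds
    \<open>\<theta> / c * t\<close>; the first case gives the larger
    \<open>1 - \<theta>\<close>.\<close>
  define \<eta> where "\<eta> = (1 - \<theta>) * (\<theta> / c)"
  have \<eta>: "0 < \<eta>"
    using \<theta> c by (auto simp: \<eta>_def)
  have \<eta>le: "\<eta> \<le> 1 - \<theta>"
  proof -
    have "\<theta> / c \<le> 1"
      using \<theta> c by simp
    then have "(1 - \<theta>) * (\<theta> / c) \<le> (1 - \<theta>) * 1"
      using \<theta> by (intro mult_left_mono) auto
    then show ?thesis
      by (simp add: \<eta>_def)
  qed
  \<comment> \<open>For \<open>k \<ge> c / \<theta>\<close> the zone preceding \<open>fact k\<close>
    ends by \<open>\<theta> * fact k\<close>; the successor in \<open>K\<close> ensures that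
    \<open>k\<close> has a predecessor.\<close>
  obtain K0 :: nat where K0: "c / \<theta> \<le> real K0"
    using real_arch_simple by blast
  define K where "K = Suc K0"
  have zone_iff: "m \<in> zones (ereal c) \<longleftrightarrow> (\<exists>k. fact k < m \<and> real m \<le> c * fact k)" for m
    by (auto simp: zones_def)
  have lower: "real m \<le> c * fact k" if "real m \<le> c * fact j" "j \<le> k" for m j k
  proof -
    have "c * fact j \<le> c * fact k"
      using c that(2) by (intro mult_left_mono fact_mono) auto
    with that(1) show ?thesis
      by linarith
  qed
  show ?thesis
  proof (rule that[OF \<eta>])
    fix s t :: nat
    assume t: "fact K \<le> t" and st: "\<rho> * real s \<le> real t"
    have s\<theta>: "real s \<le> \<theta> * real t"
    proof -
      have "1 * real s \<le> \<theta> * \<rho> * real s"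
        using \<theta>\<rho> by (intro mult_right_mono) auto
      also have "\<dots> \<le> \<theta> * real t"
        using st \<theta> by (simp add: mult.assoc)
      finally show ?thesis
        by simp
    qed
    define k where "k = (GREATEST k. fact k \<le> t)"
    have bound: "\<And>k. fact k \<le> t \<Longrightarrow> k \<le> t"
      using fact_ge_self le_trans by blast
    have k: "fact k \<le> t"
      using GreatestI_nat[of "\<lambda>k. fact k \<le> t" K t] t bound unfolding k_def by blast
    have Kk: "K \<le> k"
      using Greatest_le_nat[of "\<lambda>k. fact k \<le> t" K t] t bound unfolding k_def by blast
    have tk: "t < fact (Suc k)"
    proof (rule ccontr)
      assume "\<not> t < fact (Suc k)"
      then have "fact (Suc k) \<le> t"
        by (simp only: not_less)
      then have "Suc k \<le> k"
        using Greatest_le_nat[of "\<lambda>k. fact k \<le> t" "Suc k" t] bound unfolding k_def by blast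
      then show False
        by simp
    qed
    show "\<exists>p q. s \<le> p \<and> q \<le> t \<and> {p<..q} \<inter> zones (ereal c) = {} \<and> \<eta> * real t \<le> real q - real p"
    proof (cases "c * fact k \<le> \<theta> * real t")
      case True
      define p where "p = max s (nat \<lfloor>c * fact k\<rfloor>)"
      show ?thesis
      proof (intro exI conjI)
        have "m \<notin> zones (ereal c)" if "p < m" "m \<le> t" for m
        proof
          assume "m \<in> zones (ereal c)"
          then obtain j where j: "fact j < m" "real m \<le> c * fact j"
            unfolding zone_iff by blast
          have "j < Suc k"
          proof (rule ccontr)
            assume "\<not> j < Suc k"
            then have "(fact (Suc k) :: nat) \<le> fact j"
              by (intro fact_mono_nat) simp
            with j(1) that(2) tk show False
              by linarith
          qed
          then have "real m \<le> c * fact k"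
            using lower j(2) by simp
          then have "m \<le> nat \<lfloor>c * fact k\<rfloor>"
            by (simp add: le_nat_floor)
          then show False
            using that(1) by (simp add: p_def)
        qed
        then show "{p<..t} \<inter> zones (ereal c) = {}"
          by auto
        have "0 \<le> c * fact k"
          using c by simp
        then have "real (nat \<lfloor>c * fact k\<rfloor>) \<le> \<theta> * real t"
          using True of_nat_floor[of "c * fact k"] by linarith
        then have "real p \<le> \<theta> * real t"
          using s\<theta> unfolding p_def of_nat_max by (rule max.boundedI[rotated])
        moreover have "\<eta> * real t \<le> (1 - \<theta>) * real t"
          using \<eta>le by (intro mult_right_mono) auto
        ultimately show "\<eta> * real t \<le> real t - real p"
          by (simp add: algebra_simps)
      qed (auto simp: p_def)
    next
      case False
      obtain k' where k': "k = Suc k'"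
        using Kk by (cases k) (auto simp: K_def)
      define p where "p = max s (nat \<lfloor>c * fact k'\<rfloor>)"
      have ft: "\<theta> * real t < c * fact k"
        using False by simp
      show ?thesis
      proof (intro exI conjI)
        have "m \<notin> zones (ereal c)" if "p < m" "m \<le> fact k" for m
        proof
          assume "m \<in> zones (ereal c)"
          then obtain j where j: "fact j < m" "real m \<le> c * fact j"
            unfolding zone_iff by blast
          have "j < k"
          proof (rule ccontr)
            assume "\<not> j < k"
            then have "(fact k :: nat) \<le> fact j"
              by (intro fact_mono_nat) simp
            with j(1) that(2) show False
              by linarith
          qed
          then have "real m \<le> c * fact k'"
            using lower j(2) k' by simp
          then have "m \<le> nat \<lfloor>c * fact k'\<rfloor>"
            by (simp add: le_nat_floor)
          then show False
            using that(1) by (simp add: p_def)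
        qed
        then show "{p<..fact k} \<inter> zones (ereal c) = {}"
          by auto
        have "c * fact k' \<le> \<theta> * fact k"
        proof -
          have "c / \<theta> \<le> real k"
            using K0 Kk unfolding K_def by linarith
          then have "c \<le> \<theta> * real k"
            using \<theta> by (simp add: pos_divide_le_eq mult.commute)
          then have "c * fact k' \<le> \<theta> * real k * fact k'"
            by (intro mult_right_mono) auto
          then show ?thesis
            by (simp add: k' algebra_simps)
        qed
        \<comment> \<open>Multiplied by \<open>\<theta> * \<rho>\<close>, this follows from
          \<open>\<rho> * s \<le> t\<close> and \<open>\<theta> * t < c * fact k\<close>, because
          \<open>c = \<theta> * \<theta> * \<rho>\<close>.\<close>
        moreover have "real s \<le> \<theta> * fact k"
        proof -
          have "\<theta> * \<rho> * real s \<le> \<theta> * real t"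
            using st \<theta> by (simp add: mult.assoc)
          also have "\<dots> \<le> \<theta> * \<rho> * (\<theta> * fact k)"
            using ft unfolding \<theta>(3)[symmetric] by (simp only: mult_ac less_imp_le)
          finally show ?thesis
            using \<theta> c by (subst (asm) mult_le_cancel_left_pos) auto
        qed
        moreover have "0 \<le> c * fact k'"
          using c by simp
        ultimately have "real s \<le> \<theta> * fact k" "real (nat \<lfloor>c * fact k'\<rfloor>) \<le> \<theta> * fact k"
          using of_nat_floor[of "c * fact k'"] by linarith+
        then have "real p \<le> \<theta> * fact k"
          unfolding p_def of_nat_max by (rule max.boundedI)
        moreover have "\<eta> * real t \<le> (1 - \<theta>) * fact k"
        proof -
          have "\<theta> / c * real t \<le> fact k"
            using ft c by (simp add: pos_divide_le_eq mult.commute)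
          then have "(1 - \<theta>) * (\<theta> / c * real t) \<le> (1 - \<theta>) * fact k"
            using \<theta> by (intro mult_left_mono) auto
          then show ?thesis
            by (simp add: \<eta>_def)
        qed
        ultimately show "\<eta> * real t \<le> real (fact k) - real p"
          by (simp add: algebra_simps)
      qed (use k in \<open>auto simp: p_def\<close>)
    qed
  qed
qed

section \<open>Upper bound by counting mismatches\<close>

text \<open>With \<open>\<epsilon> = \<eta> / 2\<close> the exceptional intervals cover at most half
  of the guaranteed length \<open>\<eta> * R\<close> of a zone-free interval. No matched run there
  can contain two consecutive squares, so the matched part is only of order
  \<open>\<delta> * sqrt R\<close>, which is too small for large \<open>R\<close>.\<close>

lemma not_rdio_condition_zone_word:
  assumes dist: "x \<noteq> y" "x \<noteq> z" "y \<noteq> z"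
    and c: "1 \<le> c" "c < \<rho>"
  shows "\<not> rdio_condition (zone_word w (ereal c) x y z) \<rho>"
proof
  let ?a = "zone_word w (ereal c) x y z"
  assume cond: "rdio_condition ?a \<rho>"
  obtain \<eta> T where \<eta>: "0 < \<eta>" and free: "\<And>s t :: nat. T \<le> t \<Longrightarrow> \<rho> * real s \<le> real t \<Longrightarrow>
      \<exists>p q. s \<le> p \<and> q \<le> t \<and> {p<..q} \<inter> zones (ereal c) = {} \<and> \<eta> * real t \<le> real q - real p"
    using zone_free_interval[OF c] by blast
  obtain r s t \<delta> where rst: "\<And>n. -1 \<le> r n \<and> r n < s n \<and> s n < (t n :: int)"
    and ts: "\<And>n. \<rho> * real_of_int (s n) \<le> real_of_int (t n)"
    and lim: "filterlim (\<lambda>n. s n - r n) at_top sequentially"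
    and close: "\<forall>\<^sub>F n in sequentially. eps_delta_close (\<eta> / 2) \<delta>
          (factor ?a (r n + 1) (r n + t n - s n)) (factor ?a (s n + 1) (t n))"
    using cond[unfolded rdio_condition_def, rule_format, of "\<eta> / 2"] \<eta> by auto
  \<comment> \<open>Since \<open>\<delta>\<close> is fixed before \<open>n\<close>, thresholds may
    depend on it. In \<open>M\<close>, \<open>T\<close> makes the zone-free interval available,
    \<open>length w ^ 4\<close> puts the squares used far beyond the prefix, and
    \<open>B\<^sup>2\<close> decides the final comparison.\<close>
  obtain B :: nat where B: "16 * (real \<delta> + 1) / \<eta> + 1 < real B"
    using reals_Archimedean2 by blast
  define M where "M = max (max T ((length w) ^ 4)) (B\<^sup>2)"
  have "\<forall>\<^sub>F n in sequentially. int M + 1 \<le> s n - r n"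
    using lim by (simp add: filterlim_at_top)
  with close have "\<exists>n. eps_delta_close (\<eta> / 2) \<delta>
          (factor ?a (r n + 1) (r n + t n - s n)) (factor ?a (s n + 1) (t n)) \<and>
          int M + 1 \<le> s n - r n"
    using eventually_happens'[OF sequentially_bot eventually_conj] by blast
  then obtain n where close: "eps_delta_close (\<eta> / 2) \<delta>
          (factor ?a (r n + 1) (r n + t n - s n)) (factor ?a (s n + 1) (t n))"
      and Mn: "int M + 1 \<le> s n - r n"
    by blast
  define S R where "S = nat (s n)" and "R = nat (t n)"
  \<comment> \<open>As \<open>r n \<ge> -1\<close>, a large difference \<open>s n - r n\<close>
    forces \<open>s n\<close> itself to be large.\<close>
  have MS: "M \<le> S" "S < R"
    using Mn rst[of n] unfolding S_def R_def by auto
  have "\<rho> * real S \<le> real R"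
    using ts[of n] rst[of n] unfolding S_def R_def by simp
  then obtain p q where pq: "S \<le> p" "q \<le> R" "{p<..q} \<inter> zones (ereal c) = {}"
      "\<eta> * real R \<le> real q - real p"
    using free[of R S] MS unfolding M_def by force
  obtain l u where lu: "real (card (\<Union>j\<in>{1..\<delta>}. {l j..u j})) \<le> \<eta> / 2 * real (nat (t n - s n))"
    and match: "\<And>i. i \<in> {nat (s n)<..nat (t n)} - (\<Union>j\<in>{1..\<delta>}. {l j..u j}) \<Longrightarrow> ?a i = ?a (i - nat (s n - r n))"
    using rst[of n, THEN conjunct1] rst[of n, THEN conjunct2, THEN conjunct1]
      rst[of n, THEN conjunct2, THEN conjunct2] close
    by (rule eps_delta_close_factorD) (rule that)
  note match = match[folded S_def R_def]
  define U where "U = (\<Union>j\<in>{1..\<delta>}. {l j..u j})"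
  \<comment> \<open>With \<open>R < (h + 1)\<^sup>2\<close>, every window of length
    \<open>4 * h + 4\<close> inside the interval contains two consecutive squares, so a window
    missing all exceptional intervals would repeat a gap.\<close>
  define h where "h = nat \<lfloor>sqrt (real R)\<rfloor>"
  have h: "real h \<le> sqrt (real R)" "sqrt (real R) < real h + 1"
    unfolding h_def by auto
  have "sqrt (real R) ^ 2 < (real h + 1) ^ 2"
    using h(2) by (intro power_strict_mono) auto
  then have "real R < real ((h + 1)\<^sup>2)"
    by (simp add: add.commute)
  then have hR: "R < (h + 1)\<^sup>2"
    using of_nat_less_iff by blast
  have "card ({p<..q} - U) \<le> (\<delta> + 1) * (4 * h + 4)"
    unfolding U_def
  proof (rule card_diff_UN_intervals_le)
    fix v assume v: "p \<le> v" "v + (4 * h + 4) \<le> q"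
    show "{v<..v + (4 * h + 4)} \<inter> (\<Union>j\<in>{1..\<delta>}. {l j..u j}) \<noteq> {}"
    proof
      assume empty: "{v<..v + (4 * h + 4)} \<inter> (\<Union>j\<in>{1..\<delta>}. {l j..u j}) = {}"
      have "v < (h + 1)\<^sup>2"
        using v pq hR by linarith
      then obtain k where k: "v < k\<^sup>2" "(k + 1)\<^sup>2 \<le> v + (4 * h + 4)"
        using consecutive_squares_in_interval by blast
      have sub: "{k\<^sup>2..(k + 1)\<^sup>2} \<subseteq> {v<..v + (4 * h + 4)}"
        using k by auto
      have subpq: "{k\<^sup>2..(k + 1)\<^sup>2} \<subseteq> {p<..q}"
        using k v by auto
      then have subSR: "{k\<^sup>2..(k + 1)\<^sup>2} \<subseteq> {S<..R}"
        using pq(1,2) by auto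
      have "((length w)\<^sup>2)\<^sup>2 < k\<^sup>2"
        using MS k(1) v(1) pq(1) unfolding M_def by (auto simp flip: power_mult)
      then have "(length w)\<^sup>2 < k"
        by (rule power_less_imp_less_base) simp
      moreover have "0 < nat (s n - r n)"
        using rst[of n] by simp
      moreover have "nat (s n - r n) \<le> k\<^sup>2"
        using k(1) v(1) pq(1) rst[of n] unfolding S_def by linarith
      moreover have "{k\<^sup>2..(k + 1)\<^sup>2} \<inter> zones (ereal c) = {}"
        using subpq pq(3) by blast
      moreover have "?a i = ?a (i - nat (s n - r n))" if "i \<in> {k\<^sup>2..(k + 1)\<^sup>2}" for i
      proof (rule match)
        show "i \<in> {S<..R} - (\<Union>j\<in>{1..\<delta>}. {l j..u j})"
          using that sub subSR empty by blast
      qed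
      ultimately show False
        using zone_word_no_shifted_gap[OF dist] by blast
    qed
  qed
  then have "real (card ({p<..q} - U)) \<le> real ((\<delta> + 1) * (4 * h + 4))"
    by (rule of_nat_mono)
  then have "real (card ({p<..q} - U)) \<le> (real \<delta> + 1) * (4 * real h + 4)"
    by (simp only: of_nat_mult of_nat_add of_nat_1 of_nat_numeral)
  moreover have "real (card {p<..q}) \<le> real (card ({p<..q} - U)) + real (card U)"
  proof -
    have "finite U"
      by (simp add: U_def)
    then have "card {p<..q} \<le> card (({p<..q} - U) \<union> U)"
      by (intro card_mono) auto
    also have "\<dots> \<le> card ({p<..q} - U) + card U"
      by (rule card_Un_le)
    finally show ?thesis
      by linarith
  qed
  moreover have "real (card U) \<le> \<eta> / 2 * real R"
  proof -
    have "real (nat (t n - s n)) \<le> real R"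
      using rst[of n] unfolding R_def by (simp add: of_nat_mono)
    then have "\<eta> / 2 * real (nat (t n - s n)) \<le> \<eta> / 2 * real R"
      using \<eta> by (intro mult_left_mono) auto
    with lu show ?thesis
      unfolding U_def by linarith
  qed
  moreover have "real (card {p<..q}) \<ge> \<eta> * real R"
    using pq(4) by simp
  ultimately have "\<eta> / 2 * real R \<le> (real \<delta> + 1) * (4 * real h + 4)"
    by linarith
  also have "\<dots> \<le> (real \<delta> + 1) * (8 * sqrt (real R))"
  proof (rule mult_left_mono)
    have "1 \<le> sqrt (real R)"
      using MS by simp
    then show "4 * real h + 4 \<le> 8 * sqrt (real R)"
      using h(1) by linarith
  qed simp
  finally have "sqrt (real R) * (\<eta> * sqrt (real R)) \<le> sqrt (real R) * (16 * (real \<delta> + 1))"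
    by (simp add: algebra_simps)
  then have "\<eta> * sqrt (real R) \<le> 16 * (real \<delta> + 1)"
    using MS by (subst (asm) mult_le_cancel_left_pos) auto
  then have "sqrt (real R) \<le> 16 * (real \<delta> + 1) / \<eta>"
    using \<eta> by (simp add: pos_le_divide_eq mult.commute)
  moreover have "real B \<le> sqrt (real R)"
  proof (rule real_le_rsqrt)
    have "B\<^sup>2 \<le> R"
      using MS unfolding M_def by simp
    then show "(real B)\<^sup>2 \<le> real R"
      by (simp flip: of_nat_power)
  qed
  ultimately show False
    using B by linarith
qed

section \<open>Exact exponent and density\<close>

lemma Rdio_zone_word:
  assumes "x \<noteq> y" "x \<noteq> z" "y \<noteq> z" "1 \<le> c"
  shows "Rdio (zone_word w c x y z) = c"
proof (rule antisym)
  show "Rdio (zone_word w c x y z) \<le> c"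
  proof (rule Rdio_le[OF assms(4)])
    fix \<rho> assume "c < ereal \<rho>"
    \<comment> \<open>A value below a real and at least 1 is finite; for
      \<open>c = \<infinity>\<close> the upper bound is vacuous.\<close>
    then obtain c' where "c = ereal c'"
      using assms(4) by (cases c) auto
    then show "\<not> rdio_condition (zone_word w c x y z) \<rho>"
      using not_rdio_condition_zone_word[OF assms(1-3)] assms(4) \<open>c < ereal \<rho>\<close> by simp
  qed
  show "c \<le> Rdio (zone_word w c x y z)"
  \<comment> \<open>It suffices to reach every \<open>d < c\<close>: the zones do so for real
    \<open>d \<ge> 1\<close>, and smaller \<open>d\<close> lie below the general bound 1.\<close>
  proof (rule dense_le)
    fix d assume "d < c"
    show "d \<le> Rdio (zone_word w c x y z)"
    proof (cases "1 \<le> d")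
      case True
      then obtain \<rho> where "d = ereal \<rho>"
        using \<open>d < c\<close> by (cases d) auto
      then show ?thesis
        using True \<open>d < c\<close> by (auto intro!: Rdio_ge rdio_condition_zone_word)
    next
      case False
      then show ?thesis
        using Rdio_ge_1 by (meson linear order_trans)
    qed
  qed
qed

theorem theorem1p3:
  fixes \<Sigma> :: "'a set" and c :: ereal
  assumes "infinite \<Sigma> \<or> card \<Sigma> \<ge> 3"
    and "1 \<le> c"
  shows "cantor_topology \<Sigma> closure_of {a \<in> infinite_words \<Sigma>. Rdio a = c} = infinite_words \<Sigma>"
proof -
  obtain D where "D \<subseteq> \<Sigma>" "card D = 3"
    using assms(1) by (meson infinite_arbitrarily_large obtain_subset_with_card_n)
  then obtain x y z where xyz: "x \<in> \<Sigma>" "y \<in> \<Sigma>" "z \<in> \<Sigma>" and dist: "x \<noteq> y" "x \<noteq> z" "y \<noteq> z"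
    by (auto simp: card_3_iff)
  have "b \<in> cantor_topology \<Sigma> closure_of {a \<in> infinite_words \<Sigma>. Rdio a = c}"
    if b: "b \<in> infinite_words \<Sigma>" for b
    unfolding in_closure_of
  proof (intro conjI allI impI)
    show "b \<in> topspace (cantor_topology \<Sigma>)"
      using b by simp
    fix T assume "b \<in> T \<and> openin (cantor_topology \<Sigma>) T"
    then obtain w where w: "w \<in> lists \<Sigma>" "cylinder \<Sigma> w \<subseteq> T"
      unfolding openin_cantor_topology_iff by blast
    \<comment> \<open>Starting with \<open>w\<close> places the word in the cylinder inside
      \<open>T\<close>, while its exponent is \<open>c\<close> for every prefix.\<close>
    have "zone_word w c x y z \<in> infinite_words \<Sigma>"
      using w(1) xyz by (auto simp: infinite_words_def zone_word_def in_lists_conv_set)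
    moreover from this have "zone_word w c x y z \<in> cylinder \<Sigma> w"
      by (auto simp: cylinder_def zone_word_def)
    ultimately show "\<exists>a. a \<in> {a \<in> infinite_words \<Sigma>. Rdio a = c} \<and> a \<in> T"
      using Rdio_zone_word[OF dist assms(2)] w(2) by blast
  qed
  then show ?thesis
    using closure_of_subset_topspace[of "cantor_topology \<Sigma>"] by auto
qed

end
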